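(* Let $G$ be an infinite graph of bounded degree, and let $b_n=\sup_{x\in VG}|B_n(x)|$ for integers $n\ge 1$. (1) Let $d>0$. If there are constants $K_1,K_2>0$ such that $\frac{K_1}{n^{1/d}}\le \Lambda_G(n)\le \frac{K_2}{n^{1/d}}$ for all $n\ge 1$, then there is a constant $K_3>0$ such that for all integers $n\ge 2$, $\frac{\mathrm{Sep}_G(n)}{n}\ge \frac{K_3}{n^{1/d}}$. (2) Let $d>0$. If there is a constant $K_1>0$ such that $b_n\le K_1 n^d$ for all $n\ge 1$, then there is a constant $K_2>0$ such that for all integers $n\ge 2$, $\frac{\mathrm{Sep}_G(n)}{n}\le \frac{K_2\log n}{n^{1/d}}$. (3) Let $\epsilon>0$ and $d>0$. If $G$ has $(1+\epsilon)$-dimensional isoperimetry and there is a constant $K>0$ such that $b_n\le K n^d$ for all $n\ge1$, then for any $\delta>d$ there are constants $K_1,K_2>0$ such that for all integers $n\ge 2$, $$\frac{K_1\, n^{\epsilon(1+\epsilon)/\delta^2}}{\log n}\le \mathrm{Sep}_G(n)\le K_2\, n^{(d-1)/d}\log n .$$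
   Context: A graph $G$ has vertex set $VG$ and edge set $EG\subset VG\times VG$; adjacency is undirected. For $A\subset VG$, the boundary is $\partial A=\{(a,b)\in EG : \text{exactly one of } a,b \text{ lies in } A\}$. $B_n(x)$ is the ball of radius $n$ centred at $x$ for the combinatorial distance. The isoperimetric profile is $\Lambda_G(n)=\inf\{|\partial A|/|A| : A\subset VG,\ 1\le |A|\le n\}$. The graph $G$ has $D$-dimensional isoperimetry if there is $K>0$ with $\Lambda_G(n)\ge K n^{-1/D}$ for all $n\ge 1$. For a finite graph $H$, the Cheeger constant is $h(H)=\min\{|\partial_H A|/|A| : \emptyset\ne A\subset VH,\ |A|\le |VH|/2\}$, where $\partial_H$ is the boundary in $H$. For a finite $F\subset VG$, $h(F)$ is the Cheeger constant of the subgraph of $G$ induced on $F$, with the convention $h(F)=0$ if $|F|\le 1$. The separation profile is $\mathrm{Sep}_G(n)=\sup\{|F|\, h(F) : F\subset VG,\ |F|\le n\}$.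
   Formalization: In (2) the formal statement additionally assumes that G is connected or d ≥ 1; without this the claim fails, e.g. for infinitely many disjoint edges with d = 1/2, where b_n = 2 but Sep_G(n) stays bounded below by a positive constant. *)

theory Defs
  imports Complex_Main "Graph_Theory.Graph_Theory"
begin

text \<open>
  A graph is a symmetric digraph in the sense of \<^locale>\<open>pair_sym_digraph\<close>: the edge set is a
  symmetric subset of the square of the vertex set. An undirected edge is therefore counted
  twice in \<open>edge_boundary\<close>. Loops are allowed; they never occur in a boundary.
  All the quantities below are meant for graphs of bounded degree, where the boundaries of
  finite sets and the balls are finite and the suprema are taken over bounded sets.
\<close>

definition bounded_degree :: "('a, 'b) pre_digraph \<Rightarrow> bool" where
  "bounded_degree G \<longleftrightarrow>
     (\<exists>D. \<forall>x \<in> verts G. finite (out_arcs G x) \<and> out_degree G x \<le> D)"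

definition edge_boundary :: "('a, 'b) pre_digraph \<Rightarrow> 'a set \<Rightarrow> 'b set" where
  "edge_boundary G A = {e \<in> arcs G. (tail G e \<in> A) \<noteq> (head G e \<in> A)}"

text \<open>
  The combinatorial distance is the shortest-path distance for the constant weight 1; it is
  infinite between different components.
\<close>

definition graph_ball :: "('a, 'b) pre_digraph \<Rightarrow> 'a \<Rightarrow> nat \<Rightarrow> 'a set" where
  "graph_ball G x n = {y \<in> verts G. wf_digraph.\<mu> G (\<lambda>_. 1) x y \<le> ereal (real n)}"

definition growth :: "('a, 'b) pre_digraph \<Rightarrow> nat \<Rightarrow> real" where
  "growth G n = (SUP x \<in> verts G. real (card (graph_ball G x n)))"

text \<open>The condition \<open>1 \<le> card A\<close> includes finiteness of \<open>A\<close>.\<close>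

definition iso_profile :: "('a, 'b) pre_digraph \<Rightarrow> nat \<Rightarrow> real" where
  "iso_profile G n =
     (INF A \<in> {A. A \<subseteq> verts G \<and> 1 \<le> card A \<and> card A \<le> n}.
        real (card (edge_boundary G A)) / real (card A))"

definition has_dim_isoperimetry :: "('a, 'b) pre_digraph \<Rightarrow> real \<Rightarrow> bool" where
  "has_dim_isoperimetry G D \<longleftrightarrow>
     (\<exists>K > 0. \<forall>n \<ge> 1. iso_profile G n \<ge> K * real n powr (- 1 / D))"

text \<open>Meaningful for finite graphs with at least two vertices.\<close>

definition cheeger :: "('a, 'b) pre_digraph \<Rightarrow> real" where
  "cheeger H =
     Min ((\<lambda>A. real (card (edge_boundary H A)) / real (card A)) `
          {A. A \<subseteq> verts H \<and> A \<noteq> {} \<and> real (card A) \<le> real (card (verts H)) / 2})"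

definition cheeger_on :: "('a, 'b) pre_digraph \<Rightarrow> 'a set \<Rightarrow> real" where
  "cheeger_on G F = (if card F \<le> 1 then 0 else cheeger (G \<restriction> F))"

definition separation_profile :: "('a, 'b) pre_digraph \<Rightarrow> nat \<Rightarrow> real" where
  "separation_profile G n =
     (SUP F \<in> {F. F \<subseteq> verts G \<and> finite F \<and> card F \<le> n}. real (card F) * cheeger_on G F)"

end

theory Submission
  imports Defs
begin

text \<open>
  Upper bounds: in the subgraph induced on \<open>F\<close>, every ball containing at most half of the vertices
  grows by a factor \<open>1 + h(F) / (2 D)\<close>, where \<open>D\<close> bounds the degrees, when its radius
  increases by one. Polynomial growth of
  balls therefore forces \<open>h(F)\<close> to be small. The same argument in the whole graph bounds the
  isoperimetric profile from above.

  Lower bounds: if \<open>F\<close> is optimal for \<open>\<Lambda>(2m)\<close> and is cut into \<open>A\<close> and \<open>F - A\<close>, then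
  \<open>|\<partial>A| + |\<partial>(F - A)| = |\<partial>F| + 2 |\<partial>\<^sub>F A|\<close>, which gives \<open>2 h(F) \<ge> \<Lambda>(m) - \<Lambda>(2m)\<close>. Summing over
  dyadic scales, \<open>m (\<Lambda>(m) - \<Lambda>(2\<^sup>k m)) \<le> 4 Sep(n)\<close> whenever \<open>2\<^sup>k m \<le> n\<close>, without any loss of a
  logarithm.
\<close>

section \<open>Elementary real inequalities and dyadic scales\<close>

text \<open>Serves to order exponents: two power bounds enclosing the same quantity leave a bounded
  power of \<open>n\<close> as their quotient.\<close>

lemma nonpos_exponent_of_bounded_powr:
  fixes a B :: real
  assumes "\<And>n. 1 \<le> n \<Longrightarrow> real n powr a \<le> B"
  shows "a \<le> 0"
proof (rule ccontr)
  assume "\<not> a \<le> 0"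
  then have a: "a > 0" by simp
  have B: "B \<ge> 1" using assms[of 1] by simp
  obtain n where n: "real n > (B + 1) powr (1 / a)" using reals_Archimedean2 by blast
  moreover have "(B + 1) powr (1 / a) \<ge> 1" using B a by (simp add: ge_one_powr_ge_zero)
  ultimately have n1: "1 \<le> n" by linarith
  have "B + 1 = ((B + 1) powr (1 / a)) powr a" using a B by (simp add: powr_powr)
  also have "\<dots> \<le> real n powr a" using a n by (intro powr_mono2) auto
  finally show False using assms[OF n1] by linarith
qed

text \<open>Follows from \<open>exp u \<le> 1 + u + u * u\<close> at \<open>u = t / 2\<close>. It
  turns a growth factor \<open>1 + t\<close> into an exponential rate linear in
  \<open>t\<close>.\<close>

lemma half_le_ln_one_plus:
  fixes t :: real
  assumes "0 \<le> t" "t \<le> 1"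
  shows "t / 2 \<le> ln (1 + t)"
proof -
  have "exp (t / 2) \<le> 1 + t / 2 + (t / 2)\<^sup>2" using assms by (intro exp_bound) auto
  also have "\<dots> \<le> 1 + t"
    using assms mult_left_mono[of t 1 t] by (simp add: power2_eq_square)
  finally have "t / 2 \<le> ln (1 + t)" using assms by (subst ln_ge_iff) auto
  then show ?thesis .
qed

lemma half_le_nat_floor:
  fixes x :: real
  assumes "1 \<le> x"
  shows "x / 2 \<le> real (nat \<lfloor>x\<rfloor>)" "1 \<le> nat \<lfloor>x\<rfloor>" "real (nat \<lfloor>x\<rfloor>) \<le> x"
proof -
  have "1 \<le> \<lfloor>x\<rfloor>" "real_of_int \<lfloor>x\<rfloor> \<le> x" "x < real_of_int \<lfloor>x\<rfloor> + 1"
    using assms by linarith+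
  moreover from this have "real (nat \<lfloor>x\<rfloor>) = real_of_int \<lfloor>x\<rfloor>" by simp
  ultimately show "x / 2 \<le> real (nat \<lfloor>x\<rfloor>)" "1 \<le> nat \<lfloor>x\<rfloor>" "real (nat \<lfloor>x\<rfloor>) \<le> x"
    by linarith+
qed

lemma obtain_dyadic_multiple:
  fixes m n :: nat
  assumes "1 \<le> m" "m \<le> n"
  obtains k where "2 ^ k * m \<le> n" "n < 2 * (2 ^ k * m)"
proof -
  have "\<exists>k. 2 ^ k * m \<le> n \<and> n < 2 * (2 ^ k * m)"
    using assms
  proof (induction "n - m" arbitrary: m rule: less_induct)
    case less
    show ?case
    proof (cases "n < 2 * m")
      case True
      then show ?thesis using less by (intro exI[of _ 0]) auto
    next
      case False
      then obtain k where "2 ^ k * (2 * m) \<le> n \<and> n < 2 * (2 ^ k * (2 * m))"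
        using less.hyps[of "2 * m"] less.prems by fastforce
      then show ?thesis by (intro exI[of _ "Suc k"]) (auto simp: ac_simps)
    qed
  qed
  then show ?thesis using that by blast
qed

section \<open>Balls in induced subgraphs of a bounded-degree graph\<close>

locale bounded_degree_graph = pair_sym_digraph G for G :: "'a pair_pre_digraph" +
  fixes D :: nat
  assumes degree_pos: "1 \<le> D"
    and finite_neighbours: "finite (parcs G `` {x})"
    and card_neighbours: "card (parcs G `` {x}) \<le> D"
    and infinite_verts: "infinite (pverts G)"
begin

text \<open>For \<open>x\<close> in \<open>F \<subseteq> pverts G\<close> this is the ball for the
  intrinsic distance of the subgraph induced on \<open>F\<close>. Keeping \<open>F\<close> as a
  parameter lets one expansion argument treat both finite subgraphs and, with
  \<open>F = pverts G\<close>, the whole graph.\<close>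

primrec induced_ball :: "'a set \<Rightarrow> 'a \<Rightarrow> nat \<Rightarrow> 'a set" where
  "induced_ball F x 0 = {x}"
| "induced_ball F x (Suc r) = induced_ball F x r \<union> (F \<inter> parcs G `` induced_ball F x r)"

lemma parcs_sym: "(x, y) \<in> parcs G \<Longrightarrow> (y, x) \<in> parcs G"
  using pair_sym_arcs by (auto simp: symmetric_def sym_def)

lemma finite_induced_ball: "finite (induced_ball F x r)"
proof (induction r)
  case (Suc r)
  have "parcs G `` induced_ball F x r = (\<Union>y \<in> induced_ball F x r. parcs G `` {y})" by blast
  with Suc finite_neighbours show ?case by simp
qed simp

lemma induced_ball_subset: "x \<in> F \<Longrightarrow> induced_ball F x r \<subseteq> F"
  by (induction r) auto

lemma induced_ball_mono: "F \<subseteq> F' \<Longrightarrow> induced_ball F x r \<subseteq> induced_ball F' x r"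
  by (induction r) auto

lemma induced_ball_le: "r \<le> r' \<Longrightarrow> induced_ball F x r \<subseteq> induced_ball F x r'"
  by (rule lift_Suc_mono_le[of "induced_ball F x"]) auto

lemma centre_in_induced_ball: "x \<in> induced_ball F x r"
  by (induction r) auto

text \<open>Makes the supremum in \<open>growth\<close> one over a bounded set, so that it dominates
  every single ball.\<close>

lemma card_induced_ball_le_power: "card (induced_ball F x r) \<le> (D + 1) ^ r"
proof (induction r)
  case (Suc r)
  let ?L = "induced_ball F x r"
  have UN: "parcs G `` ?L = (\<Union>y \<in> ?L. parcs G `` {y})" by blast
  then have fin: "finite (parcs G `` ?L)" using finite_induced_ball finite_neighbours by simp
  from UN have "card (parcs G `` ?L) \<le> (\<Sum>y\<in>?L. card (parcs G `` {y}))"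
    using card_UN_le[OF finite_induced_ball, of "\<lambda>y. parcs G `` {y}" F x r] by simp
  also have "\<dots> \<le> (\<Sum>y\<in>?L. D)" by (intro sum_mono card_neighbours)
  finally have "card (parcs G `` ?L) \<le> D * card ?L" by (simp add: mult.commute)
  moreover have "card (induced_ball F x (Suc r)) \<le> card ?L + card (F \<inter> parcs G `` ?L)"
    by (simp add: card_Un_le)
  moreover have "card (F \<inter> parcs G `` ?L) \<le> card (parcs G `` ?L)"
    by (intro card_mono fin) auto
  ultimately have "card (induced_ball F x (Suc r)) \<le> (D + 1) * card ?L" by simp
  also have "\<dots> \<le> (D + 1) * (D + 1) ^ r" by (intro mult_left_mono Suc) simp
  finally show ?case by simp
qed simp

lemma induced_ball_iff_awalk:
  assumes "x \<in> pverts G"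
  shows "y \<in> induced_ball (pverts G) x r \<longleftrightarrow> (\<exists>p. awalk x p y \<and> length p \<le> r)"
proof (induction r arbitrary: y)
  case 0
  show ?case using assms by (auto simp: awalk_def)
next
  case (Suc r)
  show ?case
  proof
    assume "y \<in> induced_ball (pverts G) x (Suc r)"
    then consider "y \<in> induced_ball (pverts G) x r"
      | z where "z \<in> induced_ball (pverts G) x r" "(z, y) \<in> parcs G" by auto
    then show "\<exists>p. awalk x p y \<and> length p \<le> Suc r"
    proof cases
      case 1
      with Suc show ?thesis by (meson le_SucI)
    next
      case 2
      then obtain p where p: "awalk x p z" "length p \<le> r" using Suc by blast
      have "awalk z [(z, y)] y"
        using 2 in_arcsD1 in_arcsD2 by (auto simp: awalk_def)
      with p have "awalk x (p @ [(z, y)]) y" by (blast intro: awalk_appendI)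
      with p show ?thesis by (intro exI[of _ "p @ [(z, y)]"]) auto
    qed
  next
    assume "\<exists>p. awalk x p y \<and> length p \<le> Suc r"
    then obtain p where p: "awalk x p y" "length p \<le> Suc r" by blast
    show "y \<in> induced_ball (pverts G) x (Suc r)"
    proof (cases p rule: rev_cases)
      case Nil
      with p have "y = x" by (auto simp: awalk_def)
      then show ?thesis using centre_in_induced_ball by simp
    next
      case (snoc q e)
      with p have "awalk x q (fst e)" "e \<in> parcs G" "snd e = y"
        by (auto simp: awalk_append_iff awalk_Cons_iff awalk_Nil_iff)
      moreover from this have "fst e \<in> induced_ball (pverts G) x r" using Suc[of "fst e"] p snoc by auto
      ultimately show ?thesis using in_arcsD2[of "fst e" y] by (cases e) auto
    qed
  qed
qed

lemma graph_ball_eq_induced_ball: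
  assumes "x \<in> pverts G"
  shows "graph_ball (with_proj G) x r = induced_ball (pverts G) x r"
proof -
  have cost: "awalk_cost (\<lambda>_. 1) p = real (length p)" for p :: "('a \<times> 'a) list"
    by (induction p) auto
  have "\<mu> (\<lambda>_. 1) x y \<le> ereal (real r) \<longleftrightarrow> (\<exists>p. awalk x p y \<and> length p \<le> r)" for y
  proof
    assume "\<mu> (\<lambda>_. 1) x y \<le> ereal (real r)"
    \<comment> \<open>Relaxing to a strict bound produces a walk of cost below \<open>r + 1\<close>
      without knowing that the infimum is attained; costs are integers, so its length is at most
      \<open>r\<close>.\<close>
    also have "ereal (real r) < ereal (real (Suc r))" by simp
    finally obtain p where "awalk x p y" "ereal (awalk_cost (\<lambda>_. 1) p) < ereal (real (Suc r))"
      unfolding \<mu>_def by (auto simp: INF_less_iff)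
    then show "\<exists>p. awalk x p y \<and> length p \<le> r" by (auto simp: cost)
  next
    assume "\<exists>p. awalk x p y \<and> length p \<le> r"
    then obtain p where p: "awalk x p y" "length p \<le> r" by blast
    then have "\<mu> (\<lambda>_. 1) x y \<le> ereal (awalk_cost (\<lambda>_. 1) p)" by (intro min_cost_le_walk_cost)
    also have "\<dots> \<le> ereal (real r)" using p by (simp add: cost)
    finally show "\<mu> (\<lambda>_. 1) x y \<le> ereal (real r)" .
  qed
  then show ?thesis
    using induced_ball_iff_awalk[OF assms] induced_ball_subset[OF assms]
    unfolding graph_ball_def by auto
qed

lemma card_induced_ball_le_growth:
  assumes "F \<subseteq> pverts G" "x \<in> F"
  shows "real (card (induced_ball F x r)) \<le> growth (with_proj G) r"
proof -
  have "card (induced_ball F x r) \<le> card (induced_ball (pverts G) x r)"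
    using assms by (intro card_mono finite_induced_ball induced_ball_mono)
  also have "real \<dots> \<le> growth (with_proj G) r"
    unfolding growth_def
  proof (rule cSUP_upper2)
    show "x \<in> verts (with_proj G)" using assms by auto
    then show "real (card (induced_ball (pverts G) x r)) \<le> real (card (graph_ball (with_proj G) x r))"
      by (simp add: graph_ball_eq_induced_ball)
    have "real (card (graph_ball (with_proj G) y r)) \<le> real ((D + 1) ^ r)" if "y \<in> pverts G" for y
      using card_induced_ball_le_power graph_ball_eq_induced_ball[OF that] by (simp only: of_nat_le_iff)
    then show "bdd_above ((\<lambda>x. real (card (graph_ball (with_proj G) x r))) ` verts (with_proj G))"
      by (intro bdd_aboveI[of _ "real ((D + 1) ^ r)"]) auto
  qed
  finally show ?thesis by simp
qed

section \<open>Finiteness and size of edge boundaries\<close>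

lemma edge_boundary_induced:
  "edge_boundary (with_proj G \<restriction> F) A =
     {(x, y) \<in> parcs G. x \<in> F \<and> y \<in> F \<and> (x \<in> A \<longleftrightarrow> y \<notin> A)}"
  unfolding edge_boundary_def by auto

lemma edge_boundary_eq:
  "edge_boundary (with_proj G) A = {(x, y) \<in> parcs G. x \<in> A \<longleftrightarrow> y \<notin> A}"
  unfolding edge_boundary_def by auto

lemma edge_boundary_induced_verts:
  "edge_boundary (with_proj G \<restriction> pverts G) A = edge_boundary (with_proj G) A"
  unfolding edge_boundary_induced edge_boundary_eq by (auto dest: in_arcsD1 in_arcsD2)

text \<open>At most \<open>D * card C\<close> arcs start in \<open>C\<close>, and by symmetry the
  arcs ending in \<open>C\<close> are reversals of these; hence the factor 2.\<close>

lemma card_incident_arcs: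
  assumes "finite C"
  shows "finite {(x, y) \<in> parcs G. x \<in> C \<or> y \<in> C}" (is "finite ?I")
    and "card {(x, y) \<in> parcs G. x \<in> C \<or> y \<in> C} \<le> 2 * D * card C"
proof -
  define Q where "Q = Sigma C (\<lambda>x. parcs G `` {x})"
  have finQ: "finite Q" using assms finite_neighbours by (simp add: Q_def)
  have "card Q = (\<Sum>x\<in>C. card (parcs G `` {x}))"
    unfolding Q_def using assms finite_neighbours by (intro card_SigmaI) auto
  also have "\<dots> \<le> (\<Sum>x\<in>C. D)" by (intro sum_mono card_neighbours)
  finally have "card Q \<le> (\<Sum>x\<in>C. D)" .
  then have cardQ: "card Q \<le> D * card C" by (simp add: mult.commute)
  have "(x, y) \<in> prod.swap ` Q" if "(x, y) \<in> parcs G" "y \<in> C" for x y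
    using that by (intro image_eqI[of _ _ "(y, x)"]) (auto simp: Q_def dest: parcs_sym)
  then have sub: "?I \<subseteq> Q \<union> prod.swap ` Q" by (auto simp: Q_def)
  show "finite ?I" using sub finQ by (auto intro: finite_subset)
  have "card ?I \<le> card (Q \<union> prod.swap ` Q)" using finQ sub by (intro card_mono) auto
  also have "\<dots> \<le> card Q + card (prod.swap ` Q)" by (rule card_Un_le)
  also have "\<dots> \<le> card Q + card Q" using card_image_le[OF finQ] by simp
  finally show "card ?I \<le> 2 * D * card C" using cardQ by simp
qed

lemma edge_boundary_subset_incident:
  "edge_boundary (with_proj G) A \<subseteq> {(x, y) \<in> parcs G. x \<in> A \<or> y \<in> A}"
  "edge_boundary (with_proj G \<restriction> F) A \<subseteq> {(x, y) \<in> parcs G. x \<in> A \<or> y \<in> A}"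
  unfolding edge_boundary_eq edge_boundary_induced by blast+

lemma finite_edge_boundary:
  assumes "finite A"
  shows "finite (edge_boundary (with_proj G) A)"
    and "finite (edge_boundary (with_proj G \<restriction> F) A)"
  by (rule finite_subset[OF edge_boundary_subset_incident(1) card_incident_arcs(1)[OF assms]],
      rule finite_subset[OF edge_boundary_subset_incident(2) card_incident_arcs(1)[OF assms]])

lemma card_edge_boundary_le:
  assumes "finite A"
  shows "card (edge_boundary (with_proj G) A) \<le> 2 * D * card A"
    and "card (edge_boundary (with_proj G \<restriction> F) A) \<le> 2 * D * card A"
  using card_incident_arcs[OF assms] card_mono[OF _ edge_boundary_subset_incident(1), of A]
    card_mono[OF _ edge_boundary_subset_incident(2), of A F]
  by linarith+

section \<open>Expansion against growth of balls\<close>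

text \<open>A boundary arc of a ball has its outer endpoint in the next sphere, so it is incident to
  that sphere.\<close>

lemma card_edge_boundary_induced_ball_le:
  "card (edge_boundary (with_proj G \<restriction> F) (induced_ball F x r))
     \<le> 2 * D * (card (induced_ball F x (Suc r)) - card (induced_ball F x r))"
proof -
  let ?C = "induced_ball F x (Suc r) - induced_ball F x r"
  have fin: "finite ?C" using finite_induced_ball by blast
  have "edge_boundary (with_proj G \<restriction> F) (induced_ball F x r) \<subseteq> {(x, y) \<in> parcs G. x \<in> ?C \<or> y \<in> ?C}"
    by (auto simp: edge_boundary_induced dest: parcs_sym)
  then have "card (edge_boundary (with_proj G \<restriction> F) (induced_ball F x r)) \<le> 2 * D * card ?C"
    using card_incident_arcs[OF fin] by (blast intro: order.trans card_mono)
  also have "card ?C = card (induced_ball F x (Suc r)) - card (induced_ball F x r)"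
    by (intro card_Diff_subset finite_induced_ball induced_ball_le) simp
  finally show ?thesis .
qed

text \<open>The ball itself is used as test set. The parameters \<open>h\<close> and
  \<open>M\<close> stand for a Cheeger constant with \<open>M = card F / 2\<close>, or for the
  isoperimetric profile at \<open>n\<close> with \<open>M = n\<close>.\<close>

lemma card_induced_ball_expansion:
  assumes "x \<in> F" and "real (card (induced_ball F x r)) \<le> M"
    and exp: "\<And>A. A \<subseteq> F \<Longrightarrow> finite A \<Longrightarrow> A \<noteq> {} \<Longrightarrow> real (card A) \<le> M \<Longrightarrow>
               h * real (card A) \<le> real (card (edge_boundary (with_proj G \<restriction> F) A))"
  shows "(1 + h / (2 * real D)) * real (card (induced_ball F x r)) \<le> real (card (induced_ball F x (Suc r)))"
proof -
  let ?L = "induced_ball F x r" and ?L' = "induced_ball F x (Suc r)"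
  have le: "card ?L \<le> card ?L'" by (intro card_mono finite_induced_ball induced_ball_le) simp
  have "h * real (card ?L) \<le> real (card (edge_boundary (with_proj G \<restriction> F) ?L))"
    using assms centre_in_induced_ball[of x F r] by (intro exp finite_induced_ball induced_ball_subset) auto
  also have "\<dots> \<le> real (2 * D * (card ?L' - card ?L))"
    by (intro of_nat_mono card_edge_boundary_induced_ball_le)
  also have "\<dots> = 2 * D * (real (card ?L') - real (card ?L))" using le by (simp add: of_nat_diff)
  finally show ?thesis using degree_pos by (simp add: field_simps)
qed

text \<open>Up to radius about \<open>(M / K) powr (1 / d)\<close> polynomial growth keeps the ball
  below size \<open>M\<close>, while expansion makes it grow geometrically. Comparing
  \<open>(1 + t) ^ R\<close> with \<open>M\<close> bounds \<open>t = h / (2 * D)\<close> by a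
  multiple of \<open>(1 + ln M) / R\<close>.\<close>

lemma expansion_le_of_induced_ball_growth:
  fixes h M K d :: real
  assumes "x \<in> F" and M: "1 \<le> M" and h: "0 \<le> h" and K: "0 < K" and d: "0 < d"
    and exp: "\<And>A. A \<subseteq> F \<Longrightarrow> finite A \<Longrightarrow> A \<noteq> {} \<Longrightarrow> real (card A) \<le> M \<Longrightarrow>
               h * real (card A) \<le> real (card (edge_boundary (with_proj G \<restriction> F) A))"
    and growth: "\<And>r. 1 \<le> r \<Longrightarrow> real (card (induced_ball F x r)) \<le> K * real r powr d"
  shows "h \<le> 8 * real D * K powr (1 / d) * (1 + ln M) * M powr (- 1 / d)"
proof -
  define t where "t = h / (2 * real D)"
  have D: "1 \<le> real D" using degree_pos by simp
  \<comment> \<open>Testing with one vertex gives \<open>t \<le> 1\<close>, the range in which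
    \<open>ln (1 + t) \<ge> t / 2\<close> is available.\<close>
  have "h * 1 \<le> real (card (edge_boundary (with_proj G \<restriction> F) {x}))"
    using exp[of "{x}"] assms by simp
  also have "\<dots> \<le> real (2 * D * card {x})" by (intro of_nat_mono card_edge_boundary_le) simp
  finally have "h \<le> 2 * real D" by simp
  then have t: "0 \<le> t" "t \<le> 1" using h D by (auto simp: t_def)
  \<comment> \<open>The radius at which the growth bound \<open>K * s powr d\<close> reaches
    \<open>M\<close>.\<close>
  define s where "s = (M / K) powr (1 / d)"
  have s_inv: "inverse s = K powr (1 / d) * M powr (- 1 / d)"
    using K M by (simp add: s_def powr_divide powr_minus_divide)
  have s_pos: "0 < s" using K M by (simp add: s_def)
  have lnM: "0 \<le> ln M" using M by simp
  have "t * s \<le> 4 * (1 + ln M)"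
  proof (cases "1 \<le> s")
    \<comment> \<open>No radius \<open>\<ge> 1\<close> is available here; the summand 1 in
      \<open>1 + ln M\<close> covers this case, since \<open>ln M\<close> may vanish.\<close>
    case False
    then have "t * s \<le> 1 * 1" using t s_pos by (intro mult_mono) auto
    then have "t * s \<le> 1" by simp
    also have "1 \<le> 4 * (1 + ln M)" using lnM by simp
    finally show ?thesis .
  next
    case True
    define R where "R = nat \<lfloor>s\<rfloor>"
    note R = half_le_nat_floor[OF True, folded R_def]
    have small: "real (card (induced_ball F x r)) \<le> M" if "r \<le> R" for r
    proof (cases r)
      \<comment> \<open>The growth bound is assumed only for radii from 1 on; at radius 0 the ball
        is a single vertex.\<close>
      case 0
      then show ?thesis using M by simp
    next
      case (Suc r')
      then have "real (card (induced_ball F x r)) \<le> K * real r powr d" by (intro growth) auto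
      also have "\<dots> \<le> K * s powr d" using that R K d by (intro mult_left_mono powr_mono2) auto
      also have "s powr d = M / K" using K M d by (simp add: s_def powr_powr)
      finally show ?thesis using K by simp
    qed
    have pow: "(1 + t) ^ r \<le> real (card (induced_ball F x r))" if "r \<le> R" for r
      using that
    proof (induction r)
      case (Suc r)
      have "(1 + t) ^ Suc r \<le> (1 + t) * real (card (induced_ball F x r))"
        using Suc t by (simp add: mult_left_mono)
      also have "\<dots> \<le> real (card (induced_ball F x (Suc r)))"
        unfolding t_def using Suc.prems small[of r]
        by (intro card_induced_ball_expansion[OF \<open>x \<in> F\<close> _ exp]) auto
      finally show ?case .
    qed simp
    have "(1 + t) ^ R \<le> M" using pow[of R] small[of R] by linarith
    then have "ln ((1 + t) ^ R) \<le> ln M" using t M by (intro ln_mono) auto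
    then have "real R * ln (1 + t) \<le> ln M" using t by (simp add: ln_realpow)
    \<comment> \<open>One factor 2 is lost by rounding \<open>s\<close> down to \<open>R\<close>,
      the other by the logarithm; together they give the constant 4.\<close>
    moreover have "(s / 2) * (t / 2) \<le> real R * ln (1 + t)"
      using R t s_pos half_le_ln_one_plus[OF t] by (intro mult_mono) auto
    ultimately show ?thesis using lnM by (simp add: mult.commute)
  qed
  then have "t \<le> 4 * (1 + ln M) * inverse s" using s_pos by (simp add: field_simps)
  then have "2 * real D * t \<le> 2 * real D * (4 * (1 + ln M) * inverse s)"
    using D by (intro mult_left_mono) auto
  moreover have "2 * real D * t = h" using D by (simp add: t_def)
  ultimately show ?thesis unfolding s_inv by (simp add: algebra_simps)
qed

section \<open>Basic properties of the isoperimetric profile, Cheeger constants and the separation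
  profile\<close>

lemma iso_profile_mult_le:
  assumes "A \<subseteq> pverts G" "finite A" "card A \<le> n"
  shows "iso_profile (with_proj G) n * real (card A) \<le> real (card (edge_boundary (with_proj G) A))"
proof (cases "A = {}")
  case False
  then have c: "1 \<le> card A" using assms by (simp add: Suc_le_eq card_gt_0_iff)
  have "iso_profile (with_proj G) n \<le> real (card (edge_boundary (with_proj G) A)) / real (card A)"
    unfolding iso_profile_def
    by (rule cINF_lower) (use assms c in \<open>auto intro!: bdd_belowI[of _ 0]\<close>)
  then show ?thesis using c by (simp add: field_simps)
qed simp

text \<open>The infimum is attained since degrees are bounded, so there are finitely many ratios.\<close>

lemma iso_profile_attained:
  assumes "1 \<le> n"
  obtains A where "A \<subseteq> pverts G" "finite A" "A \<noteq> {}" "card A \<le> n"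
    "iso_profile (with_proj G) n * real (card A) = real (card (edge_boundary (with_proj G) A))"
proof -
  let ?S = "{A. A \<subseteq> pverts G \<and> 1 \<le> card A \<and> card A \<le> n}"
  let ?f = "\<lambda>A. real (card (edge_boundary (with_proj G) A)) / real (card A)"
  have "?f ` ?S \<subseteq> (\<lambda>(a, b). real a / real b) ` ({..2 * D * n} \<times> {..n})"
  proof
    fix q assume "q \<in> ?f ` ?S"
    then obtain A where A: "A \<in> ?S" "q = ?f A" by blast
    then have "finite A" by (intro card_ge_0_finite) auto
    then have "card (edge_boundary (with_proj G) A) \<le> 2 * D * card A"
      by (rule card_edge_boundary_le)
    also have "\<dots> \<le> 2 * D * n" using A by simp
    finally show "q \<in> (\<lambda>(a, b). real a / real b) ` ({..2 * D * n} \<times> {..n})"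
      using A by (intro image_eqI[of _ _ "(card (edge_boundary (with_proj G) A), card A)"]) auto
  qed
  then have fin: "finite (?f ` ?S)" by (rule finite_subset) simp
  obtain x where "x \<in> pverts G" using infinite_verts by fastforce
  then have ne: "?f ` ?S \<noteq> {}" using assms by (auto intro!: exI[of _ "{x}"])
  have "iso_profile (with_proj G) n = Min (?f ` ?S)"
    unfolding iso_profile_def using fin ne by (simp add: cInf_eq_Min)
  also have "\<dots> \<in> ?f ` ?S" using fin ne by (rule Min_in)
  finally obtain A where A: "A \<in> ?S" "iso_profile (with_proj G) n = ?f A" by blast
  then have "finite A" "A \<noteq> {}" by (auto intro: card_ge_0_finite)
  with A show ?thesis by (intro that[of A]) auto
qed

lemma iso_profile_nonneg:
  assumes "1 \<le> n"
  shows "0 \<le> iso_profile (with_proj G) n"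
proof -
  obtain A where "finite A" "A \<noteq> {}"
    "iso_profile (with_proj G) n * real (card A) = real (card (edge_boundary (with_proj G) A))"
    using iso_profile_attained[OF assms] by metis
  then show ?thesis
    by (metis card_gt_0_iff of_nat_0_le_iff of_nat_0_less_iff zero_le_mult_iff not_less)
qed

lemma cheeger_on_mult_le:
  assumes "finite F" "A \<subseteq> F" "2 * card A \<le> card F"
  shows "cheeger_on (with_proj G) F * real (card A)
           \<le> real (card (edge_boundary (with_proj G \<restriction> F) A))"
proof (cases "A = {} \<or> card F \<le> 1")
  case False
  have "finite A" using assms finite_subset by blast
  with False have c: "0 < card A" by (simp add: card_gt_0_iff)
  have "cheeger (with_proj G \<restriction> F)
          \<le> real (card (edge_boundary (with_proj G \<restriction> F) A)) / real (card A)"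
    unfolding cheeger_def
    by (rule Min_le) (use assms False in auto)
  then show ?thesis using c False by (simp add: cheeger_on_def field_simps)
qed (auto simp: cheeger_on_def)

lemma cheeger_on_ge:
  assumes "finite F" "2 \<le> card F"
    and "\<And>A. A \<subseteq> F \<Longrightarrow> A \<noteq> {} \<Longrightarrow> 2 * card A \<le> card F \<Longrightarrow>
           c * real (card A) \<le> real (card (edge_boundary (with_proj G \<restriction> F) A))"
  shows "c \<le> cheeger_on (with_proj G) F"
proof -
  let ?S = "{A. A \<subseteq> F \<and> A \<noteq> {} \<and> real (card A) \<le> real (card F) / 2}"
  obtain x where x: "x \<in> F" using assms(2) by fastforce
  have S: "finite ?S" "{x} \<in> ?S" using assms x by auto
  have "c \<le> cheeger (with_proj G \<restriction> F)"
    unfolding cheeger_def induce_subgraph_verts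
  proof (intro Min.boundedI)
    fix q assume "q \<in> (\<lambda>A. real (card (edge_boundary (with_proj G \<restriction> F) A)) / real (card A)) ` ?S"
    then obtain A where A: "A \<in> ?S"
      "q = real (card (edge_boundary (with_proj G \<restriction> F) A)) / real (card A)" by blast
    then have "0 < card A" using assms(1) by (auto simp: card_gt_0_iff dest: finite_subset)
    moreover have "c * real (card A) \<le> real (card (edge_boundary (with_proj G \<restriction> F) A))"
      using A by (intro assms(3)) auto
    ultimately show "c \<le> q" using A(2) by (simp add: le_divide_eq)
  qed (use S in auto)
  then show ?thesis using assms(2) by (simp add: cheeger_on_def)
qed

lemma cheeger_on_nonneg:
  assumes "finite F"
  shows "0 \<le> cheeger_on (with_proj G) F"
  using cheeger_on_ge[OF assms, of 0] by (cases "card F \<le> 1") (auto simp: cheeger_on_def)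

text \<open>A single vertex is the test set. The bound makes the supremum in
  \<open>separation_profile\<close> one over a bounded set.\<close>

lemma cheeger_on_le_degree:
  assumes "finite F"
  shows "cheeger_on (with_proj G) F \<le> 2 * real D"
proof (cases "card F \<le> 1")
  case False
  then obtain x where "x \<in> F" by fastforce
  then have "cheeger_on (with_proj G) F * real (card {x})
      \<le> real (card (edge_boundary (with_proj G \<restriction> F) {x}))"
    using assms False by (intro cheeger_on_mult_le) auto
  also have "\<dots> \<le> real (2 * D * card {x})" by (intro of_nat_mono card_edge_boundary_le) simp
  finally show ?thesis by simp
qed (simp add: cheeger_on_def)

lemma separation_profile_ge:
  assumes "F \<subseteq> pverts G" "finite F" "card F \<le> n"
  shows "real (card F) * cheeger_on (with_proj G) F \<le> separation_profile (with_proj G) n"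
  unfolding separation_profile_def
proof (rule cSUP_upper)
  have "real (card F) * cheeger_on (with_proj G) F \<le> real n * (2 * real D)"
    if "finite F" "card F \<le> n" for F
    using that cheeger_on_le_degree cheeger_on_nonneg by (intro mult_mono) auto
  then show "bdd_above ((\<lambda>F. real (card F) * cheeger_on (with_proj G) F) `
      {F. F \<subseteq> verts (with_proj G) \<and> finite F \<and> card F \<le> n})"
    by (intro bdd_aboveI[of _ "real n * (2 * real D)"]) auto
qed (use assms in auto)

lemma separation_profile_le:
  assumes "\<And>F. F \<subseteq> pverts G \<Longrightarrow> finite F \<Longrightarrow> card F \<le> n \<Longrightarrow>
             real (card F) * cheeger_on (with_proj G) F \<le> c"
  shows "separation_profile (with_proj G) n \<le> c"
  unfolding separation_profile_def
  by (rule cSUP_least) (use assms in \<open>auto intro: exI[of _ "{}"]\<close>)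

lemma separation_profile_mono:
  assumes "m \<le> n"
  shows "separation_profile (with_proj G) m \<le> separation_profile (with_proj G) n"
  using assms by (intro separation_profile_le separation_profile_ge) auto

lemma separation_profile_nonneg: "0 \<le> separation_profile (with_proj G) n"
  using separation_profile_ge[of "{}" n] by simp

section \<open>Gaps of the isoperimetric profile bound the separation profile from below\<close>

text \<open>Arcs inside \<open>F\<close> between \<open>A\<close> and \<open>F - A\<close> lie in
  both boundaries on the left; each remaining arc there leaves \<open>F\<close> and is counted once,
  according to the side of its endpoint in \<open>F\<close>.\<close>

lemma card_edge_boundary_split:
  assumes "A \<subseteq> F" "finite F"
  shows "card (edge_boundary (with_proj G) A) + card (edge_boundary (with_proj G) (F - A))
       = card (edge_boundary (with_proj G) F) + 2 * card (edge_boundary (with_proj G \<restriction> F) A)"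
proof -
  define out where "out B = {(x, y) \<in> edge_boundary (with_proj G) F. x \<in> B \<or> y \<in> B}" for B
  let ?I = "edge_boundary (with_proj G \<restriction> F) A"
  have fin: "finite (edge_boundary (with_proj G) F)" "finite ?I" "finite (edge_boundary (with_proj G) A)"
    using assms finite_subset finite_edge_boundary by metis+
  then have fin_out: "finite (out B)" for B by (auto simp: out_def intro: rev_finite_subset)
  have "edge_boundary (with_proj G) A = ?I \<union> out A" "?I \<inter> out A = {}"
    "edge_boundary (with_proj G) (F - A) = ?I \<union> out (F - A)" "?I \<inter> out (F - A) = {}"
    "edge_boundary (with_proj G) F = out A \<union> out (F - A)" "out A \<inter> out (F - A) = {}"
    using assms(1) unfolding out_def edge_boundary_eq edge_boundary_induced by blast+
  with fin fin_out show ?thesis by (simp add: card_Un_disjoint)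
qed

text \<open>
  Take \<open>F\<close> optimal for \<open>iso_profile G (2 * m)\<close>. If the profile drops strictly between \<open>m\<close> and
  \<open>2 * m\<close>, then \<open>F\<close> has more than \<open>m\<close> vertices, and splitting \<open>F\<close> cheaply would yield a part with
  a smaller ratio.
\<close>

lemma iso_profile_gap_le_separation_profile:
  assumes "1 \<le> m"
  shows "real m * (iso_profile (with_proj G) m - iso_profile (with_proj G) (2 * m))
           \<le> 2 * separation_profile (with_proj G) (2 * m)"
proof (cases "iso_profile (with_proj G) m \<le> iso_profile (with_proj G) (2 * m)")
  case True
  then have "real m * (iso_profile (with_proj G) m - iso_profile (with_proj G) (2 * m)) \<le> 0"
    by (intro mult_nonneg_nonpos) auto
  then show ?thesis using separation_profile_nonneg[of "2 * m"] by linarith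
next
  case False
  define a where "a = iso_profile (with_proj G) m"
  define b where "b = iso_profile (with_proj G) (2 * m)"
  have ab: "b < a" using False by (simp add: a_def b_def)
  obtain F where F: "F \<subseteq> pverts G" "finite F" "F \<noteq> {}" "card F \<le> 2 * m"
    and opt: "b * real (card F) = real (card (edge_boundary (with_proj G) F))"
    using iso_profile_attained[of "2 * m"] assms unfolding b_def by (metis le_add1 mult_2 order.trans)
  have large: "m < card F"
  proof (rule ccontr)
    assume "\<not> m < card F"
    then have "a * real (card F) \<le> b * real (card F)"
      unfolding opt a_def using F by (intro iso_profile_mult_le) auto
    moreover have "0 < card F" using F by (simp add: card_gt_0_iff)
    ultimately show False using ab by simp
  qed
  have "(a - b) / 2 \<le> cheeger_on (with_proj G) F"
  proof (rule cheeger_on_ge)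
    fix A assume A: "A \<subseteq> F" "A \<noteq> {}" "2 * card A \<le> card F"
    have "finite A" using A F finite_subset by blast
    then have "a * real (card A) \<le> real (card (edge_boundary (with_proj G) A))"
      unfolding a_def using A F by (intro iso_profile_mult_le) auto
    moreover have "b * real (card (F - A)) \<le> real (card (edge_boundary (with_proj G) (F - A)))"
      unfolding b_def using F card_mono[of F "F - A"] by (intro iso_profile_mult_le) auto
    moreover have "real (card F) = real (card A) + real (card (F - A))"
      using A F \<open>finite A\<close> card_mono[of F A] by (simp add: card_Diff_subset of_nat_diff)
    \<comment> \<open>The splitting identity and optimality give
      \<open>a * card A + b * card (F - A) \<le> b * card F + 2 * card E\<close>, where
      \<open>E\<close> is the boundary of \<open>A\<close> within \<open>F\<close>; the terms in
      \<open>b\<close> leave \<open>(a - b) * card A\<close> on the left.\<close>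
    ultimately show "(a - b) / 2 * real (card A)
        \<le> real (card (edge_boundary (with_proj G \<restriction> F) A))"
      using arg_cong[OF card_edge_boundary_split[OF A(1) F(2)], of real] opt
      by (simp add: algebra_simps)
  qed (use F large assms in auto)
  then have "real m * ((a - b) / 2) \<le> real (card F) * cheeger_on (with_proj G) F"
    using large ab by (intro mult_mono) auto
  also have "\<dots> \<le> separation_profile (with_proj G) (2 * m)"
    using F by (intro separation_profile_ge)
  finally show ?thesis by (simp add: a_def b_def field_simps)
qed

text \<open>The gaps between consecutive scales telescope. The gap at scale
  \<open>2 ^ j * m\<close>, weighted with \<open>m\<close> only, costs \<open>2 / 2 ^ j\<close>
  times the separation profile, a geometric series with sum below 4.\<close>

lemma iso_profile_dyadic_gap_le_separation_profile:
  assumes "1 \<le> m" "2 ^ k * m \<le> n"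
  shows "real m * (iso_profile (with_proj G) m - iso_profile (with_proj G) (2 ^ k * m))
           \<le> 4 * separation_profile (with_proj G) n"
proof -
  let ?i = "iso_profile (with_proj G)" and ?S = "separation_profile (with_proj G)"
  \<comment> \<open>The exact partial sum of the series is needed for the induction to
    close.\<close>
  have "real m * (?i m - ?i (2 ^ k * m)) \<le> 4 * (1 - 1 / 2 ^ k) * ?S n"
    using assms(2)
  proof (induction k)
    case (Suc k)
    have "real (2 ^ k * m) * (?i (2 ^ k * m) - ?i (2 * (2 ^ k * m))) \<le> 2 * ?S (2 * (2 ^ k * m))"
      using assms(1) by (intro iso_profile_gap_le_separation_profile) auto
    also have "\<dots> \<le> 2 * ?S n"
      using Suc.prems by (intro mult_left_mono separation_profile_mono) (auto simp: ac_simps)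
    finally have "real m * (?i (2 ^ k * m) - ?i (2 ^ Suc k * m)) \<le> 2 * ?S n / 2 ^ k"
      by (simp add: field_simps)
    moreover have "real m * (?i m - ?i (2 ^ k * m)) \<le> 4 * (1 - 1 / 2 ^ k) * ?S n"
      using Suc by (simp add: algebra_simps)
    ultimately show ?case by (simp add: field_simps)
  qed simp
  also have "\<dots> \<le> 4 * 1 * ?S n"
    using separation_profile_nonneg by (intro mult_right_mono mult_left_mono) auto
  finally show ?thesis by simp
qed

text \<open>A positive profile at 1 provides an arc that is not a loop, and its two endpoints form
  the witness. This covers the small \<open>n\<close> that the scale comparison does not
  reach.\<close>

lemma separation_profile_ge_2:
  assumes "0 < iso_profile (with_proj G) 1" "2 \<le> n"
  shows "2 \<le> separation_profile (with_proj G) n"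
proof -
  obtain x where x: "x \<in> pverts G" using infinite_verts by fastforce
  have "iso_profile (with_proj G) 1 * real (card {x}) \<le> real (card (edge_boundary (with_proj G) {x}))"
    using x by (intro iso_profile_mult_le) auto
  with assms have "edge_boundary (with_proj G) {x} \<noteq> {}" by auto
  then obtain y where y: "(x, y) \<in> parcs G" "x \<noteq> y"
    unfolding edge_boundary_eq using parcs_sym by fastforce
  let ?F = "{x, y}"
  have "1 \<le> cheeger_on (with_proj G) ?F"
  proof (rule cheeger_on_ge)
    fix A assume A: "A \<subseteq> ?F" "A \<noteq> {}" "2 * card A \<le> card ?F"
    have "finite A" using A(1) finite_subset by fastforce
    moreover have c: "card A \<le> 1" using A(3) y(2) by simp
    moreover have "card A \<noteq> 0" using A(2) \<open>finite A\<close> by simp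
    ultimately have "card A = 1" by linarith
    then obtain z where "A = {z}" by (meson card_1_singletonE)
    then have "(x, y) \<in> edge_boundary (with_proj G \<restriction> ?F) A"
      using A(1) y by (auto simp: edge_boundary_induced)
    then have "0 < card (edge_boundary (with_proj G \<restriction> ?F) A)"
      using finite_edge_boundary(2)[OF \<open>finite A\<close>] by (auto simp: card_gt_0_iff)
    then show "1 * real (card A) \<le> real (card (edge_boundary (with_proj G \<restriction> ?F) A))"
      using c by linarith
  qed (use y in auto)
  moreover have "real (card ?F) * cheeger_on (with_proj G) ?F \<le> separation_profile (with_proj G) n"
    using x y assms in_arcsD2 by (intro separation_profile_ge) auto
  ultimately show ?thesis using y by simp
qed

section \<open>Constraints on the growth exponent and upper bounds from growth\<close>

text \<open>Every ball has a boundary, hence strictly grows with the radius.\<close>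

lemma one_le_growth_exponent:
  assumes bd: "\<And>A. A \<subseteq> pverts G \<Longrightarrow> finite A \<Longrightarrow> A \<noteq> {} \<Longrightarrow> edge_boundary (with_proj G) A \<noteq> {}"
    and growth: "\<And>n. 1 \<le> n \<Longrightarrow> growth (with_proj G) n \<le> K * real n powr d"
  shows "1 \<le> d"
proof -
  obtain x where x: "x \<in> pverts G" using infinite_verts by fastforce
  let ?L = "induced_ball (pverts G) x"
  have "r + 1 \<le> card (?L r)" for r
  proof (induction r)
    case (Suc r)
    have "edge_boundary (with_proj G) (?L r) \<noteq> {}"
      using x centre_in_induced_ball by (intro bd finite_induced_ball induced_ball_subset) auto
    then have "0 < card (edge_boundary (with_proj G \<restriction> pverts G) (?L r))"
      using finite_edge_boundary(1)[OF finite_induced_ball]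
      by (simp add: edge_boundary_induced_verts card_gt_0_iff)
    \<comment> \<open>A nonempty boundary forces the truncated difference of cardinalities to be
      positive.\<close>
    also note card_edge_boundary_induced_ball_le
    finally have "card (?L r) < card (?L (Suc r))" by simp
    with Suc show ?case by simp
  qed simp
  then have "real (r + 1) \<le> growth (with_proj G) r" for r
    using card_induced_ball_le_growth[OF order.refl x, of r] of_nat_mono order.trans by blast
  then have le: "real n \<le> K * real n powr d" if "1 \<le> n" for n
    using growth[OF that] order.trans[of "real n" "real (n + 1)"] by (smt (verit) of_nat_add of_nat_1)
  have "real n powr (1 - d) \<le> K" if "1 \<le> n" for n
    using le[OF that] that by (simp add: powr_diff pos_divide_le_eq)
  then have "1 - d \<le> 0" by (rule nonpos_exponent_of_bounded_powr)
  then show ?thesis by simp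
qed

text \<open>Some vertex lies outside the finite set \<open>A\<close>, and a path to it from
  \<open>A\<close> has to cross the boundary.\<close>

lemma edge_boundary_nonempty_of_connected:
  assumes conn: "Digraph_Component.connected (with_proj G)"
    and "A \<subseteq> pverts G" "finite A" "A \<noteq> {}"
  shows "edge_boundary (with_proj G) A \<noteq> {}"
proof
  assume no: "edge_boundary (with_proj G) A = {}"
  obtain x where x: "x \<in> A" using assms by blast
  have "\<not> pverts G \<subseteq> A" using infinite_verts \<open>finite A\<close> finite_subset by blast
  then obtain y where y: "y \<in> pverts G" "y \<notin> A" by blast
  have "x \<rightarrow>\<^sup>*\<^bsub>mk_symmetric (with_proj G)\<^esub> y"
    using conn x y assms(2) unfolding connected_def strongly_connected_def by auto
  then have "x \<rightarrow>\<^sup>*\<^bsub>with_proj G\<^esub> y"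
    \<comment> \<open>Connectedness is defined through the symmetric closure, which has the same
      reachability since \<open>G\<close> is symmetric.\<close>
    using reachable_mk_symmetric_eq pair_sym_arcs by blast
  then have "y \<in> A"
  proof (induction rule: reachable_induct)
    case (step z w)
    then show ?case using no unfolding edge_boundary_eq by auto
  qed (rule x)
  with y show False by blast
qed

text \<open>The expansion bound is applied inside each \<open>F\<close> with
  \<open>M = card F / 2\<close> and \<open>h\<close> its Cheeger constant.\<close>

lemma separation_profile_le_of_growth:
  fixes K d :: real
  assumes K: "0 < K" and d: "1 \<le> d"
    and growth: "\<And>n. 1 \<le> n \<Longrightarrow> growth (with_proj G) n \<le> K * real n powr d"
  obtains C where "0 < C"
    "\<And>n. 2 \<le> n \<Longrightarrow> separation_profile (with_proj G) n \<le> C * real n powr (1 - 1 / d) * ln (real n)"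
proof
  define B where "B = 8 * real D * K powr (1 / d)"
  \<comment> \<open>The middle factor absorbs \<open>1 + ln (N / 2)\<close> into a multiple of
    \<open>ln N\<close> for \<open>N \<ge> 2\<close>; the last one comes from replacing
    \<open>N / 2\<close> by \<open>N\<close>.\<close>
  define C where "C = B * (1 + 1 / ln 2) * 2 powr (1 / d)"
  have B: "0 < B" using K degree_pos by (simp add: B_def)
  then show C: "0 < C" by (simp add: C_def add_pos_pos)
  fix n :: nat assume n: "2 \<le> n"
  show "separation_profile (with_proj G) n \<le> C * real n powr (1 - 1 / d) * ln (real n)"
  proof (rule separation_profile_le)
    fix F assume F: "F \<subseteq> pverts G" "finite F" "card F \<le> n"
    let ?N = "real (card F)"
    show "?N * cheeger_on (with_proj G) F \<le> C * real n powr (1 - 1 / d) * ln (real n)"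
    proof (cases "card F \<le> 1")
      case True
      then show ?thesis using C n by (simp add: cheeger_on_def)
    next
      case False
      then have N: "2 \<le> ?N" by simp
      obtain x where x: "x \<in> F" using False by fastforce
      have "cheeger_on (with_proj G) F \<le> B * (1 + ln (?N / 2)) * (?N / 2) powr (- 1 / d)"
        unfolding B_def
      proof (rule expansion_le_of_induced_ball_growth[OF x])
        fix A assume "A \<subseteq> F" "finite A" "A \<noteq> {}" "real (card A) \<le> ?N / 2"
        then show "cheeger_on (with_proj G) F * real (card A)
            \<le> real (card (edge_boundary (with_proj G \<restriction> F) A))"
          using F by (intro cheeger_on_mult_le) auto
      next
        fix r :: nat assume "1 \<le> r"
        then show "real (card (induced_ball F x r)) \<le> K * real r powr d"
          using card_induced_ball_le_growth[OF F(1) x, of r] growth[of r] by linarith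
      qed (use N K d F cheeger_on_nonneg in auto)
      also have "(?N / 2) powr (- 1 / d) = 2 powr (1 / d) * ?N powr (- 1 / d)"
        using N by (simp add: powr_divide powr_minus_divide)
      also have "B * (1 + ln (?N / 2)) * (2 powr (1 / d) * ?N powr (- 1 / d))
          \<le> B * ((1 + 1 / ln 2) * ln ?N) * (2 powr (1 / d) * ?N powr (- 1 / d))"
      proof (intro mult_right_mono mult_left_mono)
        have "ln 2 \<le> ln ?N" using N by (intro ln_mono) auto
        then have "1 \<le> ln ?N / ln 2" by simp
        moreover have "ln (?N / 2) \<le> ln ?N" using N by (intro ln_mono) auto
        moreover have "(1 + 1 / ln 2) * ln ?N = ln ?N + ln ?N / ln 2" by (simp add: algebra_simps)
        ultimately show "1 + ln (?N / 2) \<le> (1 + 1 / ln 2) * ln ?N" by linarith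
      qed (use B in auto)
      finally have "?N * cheeger_on (with_proj G) F \<le> ?N * (C * ln ?N * ?N powr (- 1 / d))"
        by (intro mult_left_mono) (auto simp: C_def ac_simps)
      also have "\<dots> = C * ?N powr (1 - 1 / d) * ln ?N"
        using N by (simp add: powr_diff powr_minus_divide)
      \<comment> \<open>Passing from \<open>card F\<close> to \<open>n\<close> needs a nonnegative
        exponent, which is where \<open>1 \<le> d\<close> enters.\<close>
      also have "\<dots> \<le> C * real n powr (1 - 1 / d) * ln (real n)"
        using C N d F n by (intro mult_mono powr_mono2 ln_mono) auto
      finally show ?thesis .
    qed
  qed
qed

text \<open>The expansion bound in the whole graph with \<open>M = n\<close> has a logarithmic
  factor; enlarging \<open>d\<close> to \<open>\<delta>\<close> absorbs it.\<close>

lemma iso_profile_le_of_growth: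
  fixes K d \<delta> :: real
  assumes K: "0 < K" and d: "0 < d" "d < \<delta>"
    and growth: "\<And>n. 1 \<le> n \<Longrightarrow> growth (with_proj G) n \<le> K * real n powr d"
  obtains C where "0 < C"
    "\<And>n. 1 \<le> n \<Longrightarrow> iso_profile (with_proj G) n \<le> C * real n powr (- 1 / \<delta>)"
proof
  \<comment> \<open>The slack between the two exponents: \<open>ln n \<le> n powr a / a\<close> pays
    for the logarithm.\<close>
  define a where "a = 1 / d - 1 / \<delta>"
  define B where "B = 8 * real D * K powr (1 / d)"
  have a: "0 < a" using d by (simp add: a_def frac_less2)
  have B: "0 < B" using K degree_pos by (simp add: B_def)
  then show "0 < B * (1 + 1 / a)" using a by (simp add: add_pos_pos)
  fix n :: nat assume n: "1 \<le> n"
  obtain x where x: "x \<in> pverts G" using infinite_verts by fastforce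
  have "iso_profile (with_proj G) n \<le> B * (1 + ln (real n)) * real n powr (- 1 / d)"
    unfolding B_def
  proof (rule expansion_le_of_induced_ball_growth[OF x])
    fix A assume "A \<subseteq> pverts G" "finite A" "A \<noteq> {}" "real (card A) \<le> real n"
    then show "iso_profile (with_proj G) n * real (card A)
        \<le> real (card (edge_boundary (with_proj G \<restriction> pverts G) A))"
      unfolding edge_boundary_induced_verts by (intro iso_profile_mult_le) auto
  next
    fix r :: nat assume "1 \<le> r"
    then show "real (card (induced_ball (pverts G) x r)) \<le> K * real r powr d"
      using card_induced_ball_le_growth[OF order.refl x, of r] growth[of r] by linarith
  qed (use n K d iso_profile_nonneg in auto)
  also have "\<dots> \<le> B * ((1 + 1 / a) * real n powr a) * real n powr (- 1 / d)"
  proof (intro mult_right_mono mult_left_mono)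
    have "ln (real n) \<le> real n powr a / a" using n a by (intro ln_powr_bound) auto
    moreover have "1 \<le> real n powr a" using n a by (intro ge_one_powr_ge_zero) auto
    ultimately show "1 + ln (real n) \<le> (1 + 1 / a) * real n powr a" by (simp add: algebra_simps)
  qed (use B in auto)
  also have "\<dots> = B * (1 + 1 / a) * real n powr (a + - 1 / d)"
    by (simp add: mult.assoc flip: powr_add)
  also have "a + - 1 / d = - 1 / \<delta>" by (simp add: a_def)
  finally show "iso_profile (with_proj G) n \<le> B * (1 + 1 / a) * real n powr (- 1 / \<delta>)" .
qed

section \<open>Lower bounds from power bounds on the isoperimetric profile\<close>

text \<open>Matching exponents allow a fixed ratio \<open>P = 2 ^ k\<close> of scales: for large
  \<open>P\<close>, the upper bound at \<open>P * m\<close> is at most half the lower bound at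
  \<open>m\<close>, which leaves a gap of order \<open>m powr (- 1 / d)\<close>.\<close>

lemma separation_profile_ge_of_iso_profile_power:
  fixes K1 K2 d :: real
  assumes pos: "0 < K1" "0 < K2" "0 < d"
    and lower: "\<And>n. 1 \<le> n \<Longrightarrow> K1 / real n powr (1 / d) \<le> iso_profile (with_proj G) n"
    and upper: "\<And>n. 1 \<le> n \<Longrightarrow> iso_profile (with_proj G) n \<le> K2 / real n powr (1 / d)"
  obtains K3 where "0 < K3"
    "\<And>n. 2 \<le> n \<Longrightarrow> K3 / real n powr (1 / d) \<le> separation_profile (with_proj G) n / real n"
proof -
  let ?i = "iso_profile (with_proj G)" and ?S = "separation_profile (with_proj G)"
  obtain k where k: "(2 * K2 / K1) powr d < (2::real) ^ k"
    using real_arch_pow[of 2] by auto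
  define P :: nat where "P = 2 ^ k"
  have P: "1 \<le> P" by (simp add: P_def)
  have "2 * K2 / K1 = ((2 * K2 / K1) powr d) powr (1 / d)" using pos by (simp add: powr_powr)
  also have "\<dots> \<le> real P powr (1 / d)" using pos k by (intro powr_mono2) (auto simp: P_def)
  finally have PK: "K2 / real P powr (1 / d) \<le> K1 / 2" using pos P by (simp add: field_simps)
  \<comment> \<open>The second entry serves \<open>n < P\<close>, through the lower bound 2. In the
    first, 16 collects 2 from \<open>n \<le> 2 * P * m\<close>, 2 from the halved gap and 4 from the
    dyadic estimate.\<close>
  define K3 where "K3 = min (K1 / (16 * real P)) (2 / real P)"
  have "K3 / real n powr (1 / d) \<le> ?S n / real n" if n: "2 \<le> n" for n
  proof (cases "n < P")
    case True
    have "1 \<le> real n powr (1 / d)" using n pos by (intro ge_one_powr_ge_zero) auto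
    then have "K3 / real n powr (1 / d) \<le> (2 / real P) / 1"
      using P pos by (intro frac_le) (auto simp: K3_def)
    also have "\<dots> \<le> 2 / real n" using True n by (simp add: frac_le)
    also have "\<dots> \<le> ?S n / real n"
      using lower[of 1] pos n by (intro divide_right_mono separation_profile_ge_2) auto
    finally show ?thesis .
  next
    case False
    define m where "m = n div P"
    have m1: "1 \<le> m" using False P by (simp add: m_def div_greater_zero_iff Suc_le_eq)
    have mn: "2 ^ k * m \<le> n" by (simp add: m_def P_def)
    have "n < P * m + P" 
      using P mult_div_mod_eq[of P n] mod_less_divisor[of P n] unfolding m_def by linarith
    also have "\<dots> \<le> 2 * P * m" using m1 by simp
    finally have nm: "real n \<le> 2 * real P * real m" by (metis less_imp_le of_nat_le_iff of_nat_mult of_nat_numeral)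
    let ?q = "real m powr (1 / d)"
    have q: "0 < ?q" "?q \<le> real n powr (1 / d)"
      using m1 pos by (auto simp: m_def intro!: powr_mono2)
    have "?i (2 ^ k * m) \<le> K2 / real (P * m) powr (1 / d)"
      using upper[of "P * m"] m1 P by (simp add: P_def)
    also have "\<dots> = (K2 / real P powr (1 / d)) / ?q" by (simp add: powr_mult)
    also have "\<dots> \<le> (K1 / 2) / ?q" using q PK by (intro divide_right_mono) auto
    finally have "K1 / ?q - (K1 / 2) / ?q \<le> ?i m - ?i (2 ^ k * m)"
      using lower[OF m1] by linarith
    moreover have "(K1 / 2) / real n powr (1 / d) \<le> (K1 / 2) / ?q"
      using q pos by (intro divide_left_mono mult_pos_pos) linarith+
    ultimately have gap: "(K1 / 2) / real n powr (1 / d) \<le> ?i m - ?i (2 ^ k * m)"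
      by (simp add: field_simps)
    have "real n / (2 * real P) * ((K1 / 2) / real n powr (1 / d))
        \<le> real m * (?i m - ?i (2 ^ k * m))"
      using nm gap pos P by (intro mult_mono) (auto simp: field_simps)
    also have "\<dots> \<le> 4 * ?S n" using m1 mn by (rule iso_profile_dyadic_gap_le_separation_profile)
    finally have "K1 / (16 * real P) / real n powr (1 / d) \<le> ?S n / real n"
      using n P by (simp add: field_simps)
    moreover have "K3 / real n powr (1 / d) \<le> K1 / (16 * real P) / real n powr (1 / d)"
      by (intro divide_right_mono) (auto simp: K3_def)
    ultimately show ?thesis by linarith
  qed
  moreover have "0 < K3" using pos P by (simp add: K3_def)
  ultimately show ?thesis using that by blast
qed

text \<open>
  Compares the profile at \<open>m \<approx> c * n powr (s / \<delta>)\<close> with the profile at a dyadic multiple of \<open>m\<close>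
  close to \<open>n\<close>: for small \<open>c\<close> the former is at least twice as large.
\<close>

lemma separation_profile_ge_of_iso_profile_powers:
  fixes K C s \<delta> :: real
  assumes pos: "0 < K" "0 < C" "0 < s" "0 < \<delta>" and s\<delta>: "s \<le> \<delta>"
    and lower: "\<And>n. 1 \<le> n \<Longrightarrow> K * real n powr (- 1 / s) \<le> iso_profile (with_proj G) n"
    and upper: "\<And>n. 1 \<le> n \<Longrightarrow> iso_profile (with_proj G) n \<le> C * real n powr (- 1 / \<delta>)"
  obtains c where "0 < c"
    "\<And>n. 2 \<le> n \<Longrightarrow> c * real n powr ((s - 1) / \<delta>) \<le> separation_profile (with_proj G) n"
proof -
  let ?i = "iso_profile (with_proj G)" and ?S = "separation_profile (with_proj G)"
  define B where "B = C * 2 powr (1 / \<delta>)"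
  \<comment> \<open>Chosen so that \<open>K * c0 powr (- 1 / s) \<ge> 2 * B\<close>, where
    \<open>B * n powr (- 1 / \<delta>)\<close> bounds the profile at every scale
    \<open>\<ge> n / 2\<close>.\<close>
  define c0 where "c0 = min 1 ((K / (2 * B)) powr s)"
  define c where "c = c0 * min 1 (B / 8)"
  have B: "0 < B" using pos by (simp add: B_def)
  have c0: "0 < c0" "c0 \<le> 1" using pos B by (auto simp: c0_def)
  have "c0 powr (1 / s) \<le> ((K / (2 * B)) powr s) powr (1 / s)"
    using pos c0 by (intro powr_mono2) (auto simp: c0_def)
  also have "\<dots> = K / (2 * B)" using pos B by (simp add: powr_powr)
  finally have "c0 powr (1 / s) * (2 * B) \<le> K" using B by (simp add: pos_le_divide_eq)
  moreover have "0 < c0 powr (1 / s)" using c0 by simp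
  ultimately have "2 * B \<le> K / c0 powr (1 / s)" by (simp add: pos_le_divide_eq mult.commute)
  then have c0_K: "2 * B \<le> K * c0 powr (- 1 / s)" by (simp add: powr_minus_divide)
  have c_le: "c \<le> c0" "c \<le> c0 * (B / 8)"
    using c0 by (auto simp: c_def mult_left_le)
  have "c * real n powr ((s - 1) / \<delta>) \<le> ?S n" if n: "2 \<le> n" for n
  proof -
    define y where "y = c0 * real n powr (s / \<delta>)"
    show ?thesis
    proof (cases "1 \<le> y")
      case False
      have "c * real n powr ((s - 1) / \<delta>) \<le> c0 * real n powr (s / \<delta>)"
        using n pos c0 c_le by (intro mult_mono powr_mono divide_right_mono) auto
      also have "\<dots> \<le> 2" using False by (simp add: y_def)
      also have "\<dots> \<le> ?S n"
        using lower[of 1] pos n by (intro separation_profile_ge_2) auto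
      finally show ?thesis .
    next
      case True
      define m where "m = nat \<lfloor>y\<rfloor>"
      note m = half_le_nat_floor[OF True, folded m_def]
      have "real n powr (s / \<delta>) \<le> real n powr 1" using n s\<delta> pos by (intro powr_mono) auto
      then have "y \<le> 1 * real n" unfolding y_def using c0 n by (intro mult_mono) auto
      then have "m \<le> n" using m by simp
      then obtain k where k: "2 ^ k * m \<le> n" "n < 2 * (2 ^ k * m)"
        using obtain_dyadic_multiple m by blast
      let ?N = "2 ^ k * m"
      \<comment> \<open>The exponent \<open>s / \<delta>\<close> in \<open>y\<close> is the one for
        which \<open>y powr (- 1 / s)\<close> decays exactly like
        \<open>n powr (- 1 / \<delta>)\<close>.\<close>
      have "2 * B * real n powr (- 1 / \<delta>) \<le> K * c0 powr (- 1 / s) * real n powr (- 1 / \<delta>)"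
        using c0_K by (intro mult_right_mono) auto
      also have "\<dots> = K * y powr (- 1 / s)"
        using pos by (simp add: y_def powr_mult powr_powr)
      also have "\<dots> \<le> K * real m powr (- 1 / s)"
        using m pos by (intro mult_left_mono powr_mono2') auto
      also have "\<dots> \<le> ?i m" using m by (intro lower)
      finally have im: "2 * B * real n powr (- 1 / \<delta>) \<le> ?i m" .
      have "real n < real (2 * ?N)" using k(2) by (simp only: of_nat_less_iff)
      then have N: "real n / 2 \<le> real ?N" by simp
      have N1: "1 \<le> ?N" using m by simp
      have "?i ?N \<le> C * real ?N powr (- 1 / \<delta>)" using N1 by (rule upper)
      also have "\<dots> \<le> C * (real n / 2) powr (- 1 / \<delta>)"
        using N n pos by (intro mult_left_mono powr_mono2') auto
      also have "\<dots> = B * real n powr (- 1 / \<delta>)"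
        by (simp add: B_def powr_divide powr_minus_divide)
      finally have "B * real n powr (- 1 / \<delta>) \<le> ?i m - ?i ?N" using im by linarith
      then have "y / 2 * (B * real n powr (- 1 / \<delta>)) \<le> real m * (?i m - ?i ?N)"
        using m B True by (intro mult_mono) auto
      also have "\<dots> \<le> 4 * ?S n"
        using m k by (intro iso_profile_dyadic_gap_le_separation_profile)
      finally have "c0 * (B / 8) * (real n powr (s / \<delta>) * real n powr (- 1 / \<delta>)) \<le> ?S n"
        by (simp add: y_def algebra_simps)
      also have "real n powr (s / \<delta>) * real n powr (- 1 / \<delta>) = real n powr ((s - 1) / \<delta>)"
        by (simp add: diff_divide_distrib flip: powr_add)
      finally have "c0 * (B / 8) * real n powr ((s - 1) / \<delta>) \<le> ?S n" .
      moreover have "c * real n powr ((s - 1) / \<delta>) \<le> c0 * (B / 8) * real n powr ((s - 1) / \<delta>)"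
        using c_le by (intro mult_right_mono) auto
      ultimately show ?thesis by linarith
    qed
  qed
  moreover have "0 < c" using c0 B by (simp add: c_def)
  ultimately show ?thesis using that by blast
qed

end

text \<open>The alternative \<open>connected\<close> or \<open>d \<ge> 1\<close> in (2) excludes
  cases where the bound fails: an infinite disjoint union of edges has bounded growth, so every
  \<open>d > 0\<close> is admissible, yet its separation profile stays above a positive constant
  while \<open>n powr (1 - 1 / d) * ln n\<close> tends to 0 for \<open>d < 1\<close>. An infinite
  connected graph satisfies the growth bound only with \<open>d \<ge> 1\<close>; in (3) the
  isoperimetric hypothesis has the same effect.\<close>

theorem theorem1p2:
  fixes G :: "'a pair_pre_digraph"
  assumes "pair_sym_digraph G"
    and "infinite (pverts G)"
    and "bounded_degree (with_proj G)"
  shows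
    "(\<forall>d::real. d > 0 \<longrightarrow>
        (\<exists>K1 > 0. \<exists>K2 > 0. \<forall>n \<ge> 1.
            K1 / real n powr (1 / d) \<le> iso_profile (with_proj G) n \<and>
            iso_profile (with_proj G) n \<le> K2 / real n powr (1 / d)) \<longrightarrow>
        (\<exists>K3 > 0. \<forall>n \<ge> 2.
            separation_profile (with_proj G) n / real n \<ge> K3 / real n powr (1 / d)))
     \<and>
     (\<forall>d::real. d > 0 \<longrightarrow>
        Digraph_Component.connected (with_proj G) \<or> d \<ge> 1 \<longrightarrow>
        (\<exists>K1 > 0. \<forall>n \<ge> 1. growth (with_proj G) n \<le> K1 * real n powr d) \<longrightarrow>
        (\<exists>K2 > 0. \<forall>n \<ge> 2.
            separation_profile (with_proj G) n / real n
              \<le> K2 * ln (real n) / real n powr (1 / d)))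
     \<and>
     (\<forall>\<epsilon>::real. \<forall>d::real. \<epsilon> > 0 \<longrightarrow> d > 0 \<longrightarrow>
        has_dim_isoperimetry (with_proj G) (1 + \<epsilon>) \<longrightarrow>
        (\<exists>K > 0. \<forall>n \<ge> 1. growth (with_proj G) n \<le> K * real n powr d) \<longrightarrow>
        (\<forall>\<delta> > d. \<exists>K1 > 0. \<exists>K2 > 0. \<forall>n \<ge> 2.
            K1 * real n powr (\<epsilon> * (1 + \<epsilon>) / \<delta>\<^sup>2) / ln (real n)
              \<le> separation_profile (with_proj G) n \<and>
            separation_profile (with_proj G) n
              \<le> K2 * real n powr ((d - 1) / d) * ln (real n)))"
proof -
  interpret pair_sym_digraph G by fact
  obtain D0 where D0: "\<And>x. x \<in> pverts G \<Longrightarrow>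
      finite (out_arcs (with_proj G) x) \<and> out_degree (with_proj G) x \<le> D0"
    using assms(3) unfolding bounded_degree_def by auto
  \<comment> \<open>The maximum with 1 makes the bound positive, as division by the degree bound
    requires; points that are not vertices have no neighbours.\<close>
  have nbr: "finite (parcs G `` {x}) \<and> card (parcs G `` {x}) \<le> max 1 D0" for x
  proof (cases "x \<in> pverts G")
    case True
    have eq: "parcs G `` {x} = snd ` out_arcs (with_proj G) x" by (force simp: out_arcs_def)
    show ?thesis unfolding eq
      using D0[OF True] card_image_le[of "out_arcs (with_proj G) x" snd]
      by (auto simp: out_degree_def)
  next
    case False
    then have "parcs G `` {x} = {}" using in_arcsD1 by blast
    then show ?thesis by simp
  qed
  interpret bounded_degree_graph G "max 1 D0"
    by unfold_locales (use nbr assms(2) in auto)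
  let ?i = "iso_profile (with_proj G)" and ?S = "separation_profile (with_proj G)"

  have part1: "\<exists>K3 > 0. \<forall>n \<ge> 2. ?S n / real n \<ge> K3 / real n powr (1 / d)"
    if "d > 0" "\<exists>K1 > 0. \<exists>K2 > 0. \<forall>n \<ge> 1.
      K1 / real n powr (1 / d) \<le> ?i n \<and> ?i n \<le> K2 / real n powr (1 / d)" for d
  proof -
    from that obtain K1 K2 where K: "K1 > 0" "K2 > 0"
      "\<And>n. 1 \<le> n \<Longrightarrow> K1 / real n powr (1 / d) \<le> ?i n"
      "\<And>n. 1 \<le> n \<Longrightarrow> ?i n \<le> K2 / real n powr (1 / d)" by blast
    obtain K3 where "0 < K3" "\<And>n. 2 \<le> n \<Longrightarrow> K3 / real n powr (1 / d) \<le> ?S n / real n"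
      by (rule separation_profile_ge_of_iso_profile_power[OF K(1,2) \<open>d > 0\<close> K(3,4)]) blast+
    then show ?thesis by blast
  qed

  have part2: "\<exists>K2 > 0. \<forall>n \<ge> 2. ?S n / real n \<le> K2 * ln (real n) / real n powr (1 / d)"
    if d: "Digraph_Component.connected (with_proj G) \<or> d \<ge> 1"
      and growth: "\<exists>K1 > 0. \<forall>n \<ge> 1. growth (with_proj G) n \<le> K1 * real n powr d" for d
  proof -
    obtain K1 where K1: "K1 > 0" "\<And>n. 1 \<le> n \<Longrightarrow> growth (with_proj G) n \<le> K1 * real n powr d"
      using growth by blast
    have "1 \<le> d"
      using d one_le_growth_exponent[OF edge_boundary_nonempty_of_connected K1(2)] by blast
    obtain C where C: "0 < C"
      "\<And>n. 2 \<le> n \<Longrightarrow> ?S n \<le> C * real n powr (1 - 1 / d) * ln (real n)"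
      by (rule separation_profile_le_of_growth[OF K1(1) \<open>1 \<le> d\<close> K1(2)]) blast+
    have "?S n / real n \<le> C * ln (real n) / real n powr (1 / d)" if "2 \<le> n" for n
      using C(2)[OF that] that by (simp add: powr_diff field_simps)
    with C(1) show ?thesis by blast
  qed

  have part3: "\<exists>K1 > 0. \<exists>K2 > 0. \<forall>n \<ge> 2.
        K1 * real n powr (\<epsilon> * (1 + \<epsilon>) / \<delta>\<^sup>2) / ln (real n) \<le> ?S n \<and>
        ?S n \<le> K2 * real n powr ((d - 1) / d) * ln (real n)"
    if pos: "\<epsilon> > 0" "d > 0" and iso: "has_dim_isoperimetry (with_proj G) (1 + \<epsilon>)"
      and growth: "\<exists>K > 0. \<forall>n \<ge> 1. growth (with_proj G) n \<le> K * real n powr d"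
      and \<delta>: "\<delta> > d" for \<epsilon> d \<delta>
  proof -
    define s where "s = 1 + \<epsilon>"
    have s: "0 < s" "0 < \<delta>" using pos \<delta> by (auto simp: s_def)
    obtain K where K: "K > 0" "\<And>n. 1 \<le> n \<Longrightarrow> growth (with_proj G) n \<le> K * real n powr d"
      using growth by blast
    obtain K' where K': "K' > 0" "\<And>n. 1 \<le> n \<Longrightarrow> K' * real n powr (- 1 / s) \<le> ?i n"
      using iso unfolding has_dim_isoperimetry_def s_def by blast
    obtain C where C: "0 < C" "\<And>n. 1 \<le> n \<Longrightarrow> ?i n \<le> C * real n powr (- 1 / \<delta>)"
      by (rule iso_profile_le_of_growth[OF K(1) pos(2) \<delta> K(2)]) blast+
    \<comment> \<open>The lower and upper bounds on the profile are compatible for all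
      \<open>n\<close> only if \<open>s \<le> \<delta>\<close>.\<close>
    have "real n powr (1 / \<delta> - 1 / s) \<le> C / K'" if n: "1 \<le> n" for n
    proof -
      have "K' / real n powr (1 / s) \<le> C / real n powr (1 / \<delta>)"
        using K'(2)[OF n] C(2)[OF n] by (simp add: powr_minus_divide)
      then show ?thesis using K'(1) n by (simp add: powr_diff field_simps)
    qed
    then have "1 / \<delta> - 1 / s \<le> 0" by (rule nonpos_exponent_of_bounded_powr)
    then have s\<delta>: "s \<le> \<delta>" using s by (simp add: field_simps)
    obtain c where c: "0 < c" "\<And>n. 2 \<le> n \<Longrightarrow> c * real n powr ((s - 1) / \<delta>) \<le> ?S n"
      by (rule separation_profile_ge_of_iso_profile_powers[OF K'(1) C(1) s s\<delta> K'(2) C(2)]) blast+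
    have lower: "c * ln 2 * real n powr (\<epsilon> * (1 + \<epsilon>) / \<delta>\<^sup>2) / ln (real n) \<le> ?S n"
      if n: "2 \<le> n" for n
    proof -
      \<comment> \<open>The bound already obtained has exponent \<open>\<epsilon> / \<delta>\<close>
        and no logarithm; since \<open>1 + \<epsilon> \<le> \<delta>\<close>, it implies the one
        claimed.\<close>
      have "\<epsilon> * (1 + \<epsilon>) \<le> \<epsilon> * \<delta>" using s\<delta> pos by (intro mult_left_mono) (auto simp: s_def)
      then have "\<epsilon> * (1 + \<epsilon>) / \<delta>\<^sup>2 \<le> \<epsilon> * \<delta> / \<delta>\<^sup>2" by (intro divide_right_mono) auto
      also have "\<dots> = (s - 1) / \<delta>" by (simp add: s_def power2_eq_square)
      finally have "\<epsilon> * (1 + \<epsilon>) / \<delta>\<^sup>2 \<le> (s - 1) / \<delta>" .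
      then have "real n powr (\<epsilon> * (1 + \<epsilon>) / \<delta>\<^sup>2) \<le> real n powr ((s - 1) / \<delta>)"
        using n by (intro powr_mono) auto
      moreover have "ln 2 / ln (real n) \<le> 1" using n by simp
      ultimately have "c * real n powr (\<epsilon> * (1 + \<epsilon>) / \<delta>\<^sup>2) * (ln 2 / ln (real n))
          \<le> c * real n powr ((s - 1) / \<delta>) * 1"
        using c(1) n by (intro mult_mono) auto
      also have "\<dots> \<le> ?S n" using c(2)[OF n] by simp
      finally show ?thesis by (simp add: ac_simps)
    qed
    \<comment> \<open>Isoperimetry takes the place of connectedness in forcing
      \<open>1 \<le> d\<close>.\<close>
    have "edge_boundary (with_proj G) A \<noteq> {}"
      if A: "A \<subseteq> pverts G" "finite A" "A \<noteq> {}" for A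
    proof -
      have "0 < real (card A)" using A by (simp add: card_gt_0_iff)
      moreover from this have "0 < ?i (card A)"
        using order.strict_trans2[OF mult_pos_pos K'(2)[of "card A"]] K'(1) by auto
      ultimately have "0 < ?i (card A) * real (card A)" by simp
      also have "\<dots> \<le> real (card (edge_boundary (with_proj G) A))"
        using A by (intro iso_profile_mult_le) auto
      finally show ?thesis by auto
    qed
    then have d: "1 \<le> d" using K(2) by (rule one_le_growth_exponent)
    obtain C2 where C2: "0 < C2"
      "\<And>n. 2 \<le> n \<Longrightarrow> ?S n \<le> C2 * real n powr (1 - 1 / d) * ln (real n)"
      by (rule separation_profile_le_of_growth[OF K(1) d K(2)]) blast+
    have "1 - 1 / d = (d - 1) / d" using d by (simp add: diff_divide_distrib)
    then show ?thesis
      using lower C2 c(1) by (intro exI[of _ "c * ln 2"] exI[of _ C2] conjI) auto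
  qed

  show ?thesis by (intro conjI allI impI; (rule part1 part2 part3; assumption))
qed

end
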